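(* Let $\mathfrak{V}$ be a vessel and let $\xi,\eta\in\mathbb{R}^d$ be such that both $\xi\sigma=\sum_{j=1}^d\xi_j\sigma_j$ and $\eta\sigma=\sum_{j=1}^d\eta_j\sigma_j$ are invertible. If $\mathfrak{V}$ satisfies the $VR$ conditions in the direction of $\xi$, then it satisfies the $VR$ conditions in the direction of $\eta$. In particular, there exists a non-empty open set $U\subset\mathrm{GL}_d(\mathbb{R})$ such that for every $T\in U$, $\mathfrak{V}$ satisfies the $VR$ conditions in the direction of $T\xi$.
   Context: A (Livsic commutative operator) vessel is a collection $\mathfrak{V}=(\mathcal{H},\mathcal{E},\Phi,\{A_j\},\{\sigma_j\},\{\gamma_{jk}\},\{\gamma_{*jk}\})$, where $\mathcal{H},\mathcal{E}$ are separable Hilbert spaces with $\mathcal{E}\neq0$, $A_1,\ldots,A_d$ are commuting bounded (not necessarily selfadjoint) operators on $\mathcal{H}$, $\Phi:\mathcal{H}\to\mathcal{E}$ is bounded, and $\sigma_j,\gamma_{jk},\gamma_{*jk}$ are bounded selfadjoint operators on $\mathcal{E}$ such that for all $j,k=1,\ldots,d$: $A_k-A_k^*=i\Phi^*\sigma_k\Phi$; $\gamma_{jk}=-\gamma_{kj}$, $\gamma_{*jk}=-\gamma_{*kj}$; $\sigma_j\Phi A_k^*-\sigma_k\Phi A_j^*=\gamma_{jk}\Phi$; $\sigma_j\Phi A_k-\sigma_k\Phi A_j=\gamma_{*jk}\Phi$; $\gamma_{*jk}-\gamma_{jk}=i(\sigma_j\Phi\Phi^*\sigma_k-\sigma_k\Phi\Phi^*\sigma_j)$.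 VR conditions in a direction. For $T=(T_{ij})\in \mathrm{GL}_d(\mathbb{R})$ put $\sigma_j^T=\sum_i T_{ij}\sigma_i$ and $\gamma_{jk}^T=\sum_{i,l}T_{ij}T_{lk}\gamma_{il}$. $\mathfrak{V}$ satisfies the VR conditions in the direction of $Te_1$ (the definition depends only on the vector $Te_1$) if $\sigma_1^T$ is invertible and, writing $s_j=\sigma_j^T$, $g_{jk}=\gamma_{jk}^T$, for all $j,k=2,\ldots,d$: $[s_1^{-1}s_j,s_1^{-1}s_k]=0$; $[s_1^{-1}g_{1j},s_1^{-1}g_{1k}]=0$; $[s_1^{-1}s_k,s_1^{-1}g_{1j}]=[s_1^{-1}s_j,s_1^{-1}g_{1k}]$; $g_{jk}=s_js_1^{-1}g_{1k}-s_ks_1^{-1}g_{1j}$. *)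

theory Defs
  imports "HOL-Analysis.Analysis"
begin

section \<open>Complex Hilbert spaces\<close>

text \<open>
  The norm, the real scalar multiplication and completeness are those of \<^class>\<open>banach\<close>; the class
  adds a compatible complex structure. The inner product is linear in its first argument.
\<close>

class complex_hilbert_space = banach +
  fixes scaleC :: "complex \<Rightarrow> 'a \<Rightarrow> 'a" (infixr "*\<^sub>C" 75)
    and cinner :: "'a \<Rightarrow> 'a \<Rightarrow> complex"
  assumes scaleC_of_real: "complex_of_real r *\<^sub>C x = r *\<^sub>R x"
    and scaleC_add_right: "c *\<^sub>C (x + y) = c *\<^sub>C x + c *\<^sub>C y"
    and scaleC_add_left: "(c + c') *\<^sub>C x = c *\<^sub>C x + c' *\<^sub>C x"
    and scaleC_scaleC: "c *\<^sub>C c' *\<^sub>C x = (c * c') *\<^sub>C x"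
    and cinner_commute: "cinner y x = cnj (cinner x y)"
    and cinner_add_left: "cinner (x + y) z = cinner x z + cinner y z"
    and cinner_scaleC_left: "cinner (c *\<^sub>C x) y = c * cinner x y"
    and cinner_self: "cinner x x = complex_of_real ((norm x)\<^sup>2)"

instantiation complex :: complex_hilbert_space
begin

definition scaleC_complex :: "complex \<Rightarrow> complex \<Rightarrow> complex"
  where "scaleC_complex c x = c * x"

definition cinner_complex :: "complex \<Rightarrow> complex \<Rightarrow> complex"
  where "cinner_complex x y = x * cnj y"

instance
  by standard
    (simp_all add: scaleC_complex_def cinner_complex_def scaleR_conv_of_real algebra_simps
      complex_mult_cnj cmod_power2)

end

definition bounded_clinear ::
    "('a::complex_hilbert_space \<Rightarrow> 'b::complex_hilbert_space) \<Rightarrow> bool"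
  where "bounded_clinear A \<longleftrightarrow> bounded_linear A \<and> (\<forall>c x. A (c *\<^sub>C x) = c *\<^sub>C A x)"

text \<open>
  For a bounded operator the adjoint exists by the Riesz representation theorem; it is unique by
  \<open>cadjoint_unique\<close> below.
\<close>

definition cadjoint ::
    "('a::complex_hilbert_space \<Rightarrow> 'b::complex_hilbert_space) \<Rightarrow> 'b \<Rightarrow> 'a"
  where "cadjoint A = (SOME B. \<forall>x y. cinner (A x) y = cinner x (B y))"

definition selfadjoint :: "('a::complex_hilbert_space \<Rightarrow> 'a) \<Rightarrow> bool"
  where "selfadjoint A \<longleftrightarrow> (\<forall>x y. cinner (A x) y = cinner x (A y))"

definition op_invertible :: "('a::complex_hilbert_space \<Rightarrow> 'a) \<Rightarrow> bool"
  where "op_invertible A \<longleftrightarrow> (\<exists>B. bounded_clinear B \<and> A \<circ> B = id \<and> B \<circ> A = id)"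

definition commutator :: "('a::complex_hilbert_space \<Rightarrow> 'a) \<Rightarrow> ('a \<Rightarrow> 'a) \<Rightarrow> 'a \<Rightarrow> 'a"
  where "commutator A B = (\<lambda>x. A (B x) - B (A x))"

lemma cadjoint_unique:
  assumes "\<And>x y. cinner (A x) y = cinner x (B y)"
  shows "cadjoint A = B"
proof
  fix y
  have "\<forall>x y. cinner (A x) y = cinner x (cadjoint A y)"
    unfolding cadjoint_def by (rule someI[of _ B]) (use assms in blast)
  then have eq: "cinner x (cadjoint A y) = cinner x (B y)" for x
    using assms by metis
  let ?d = "cadjoint A y - B y"
  have "cinner (cadjoint A y) x = cinner (B y) x" for x
    using eq[of x] cinner_commute by metis
  moreover have "cinner (cadjoint A y) ?d = cinner ?d ?d + cinner (B y) ?d"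
    using cinner_add_left[of ?d "B y" ?d] by simp
  ultimately have "cinner ?d ?d = 0"
    by simp
  then show "cadjoint A y = B y"
    by (simp add: cinner_self)
qed


section \<open>Vessels\<close>

locale vessel =
  fixes \<Phi> :: "'h::complex_hilbert_space \<Rightarrow> 'e::complex_hilbert_space"
    and A :: "'d::{finite,linorder} \<Rightarrow> 'h \<Rightarrow> 'h"
    and \<sigma> :: "'d \<Rightarrow> 'e \<Rightarrow> 'e"
    and \<gamma> :: "'d \<Rightarrow> 'd \<Rightarrow> 'e \<Rightarrow> 'e"
    and \<gamma>s :: "'d \<Rightarrow> 'd \<Rightarrow> 'e \<Rightarrow> 'e"
  assumes separable_H: "separable_space (euclidean :: 'h topology)"
    and separable_E: "separable_space (euclidean :: 'e topology)"
    and E_nonzero: "\<exists>x :: 'e. x \<noteq> 0"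
    and bounded_\<Phi>: "bounded_clinear \<Phi>"
    and bounded_A: "bounded_clinear (A k)"
    and bounded_\<sigma>: "bounded_clinear (\<sigma> j)"
    and bounded_\<gamma>: "bounded_clinear (\<gamma> j k)"
    and bounded_\<gamma>s: "bounded_clinear (\<gamma>s j k)"
    and selfadjoint_\<sigma>: "selfadjoint (\<sigma> j)"
    and selfadjoint_\<gamma>: "selfadjoint (\<gamma> j k)"
    and selfadjoint_\<gamma>s: "selfadjoint (\<gamma>s j k)"
    and A_commute: "A j (A k h) = A k (A j h)"
    and colligation: "A k h - cadjoint (A k) h = \<i> *\<^sub>C cadjoint \<Phi> (\<sigma> k (\<Phi> h))"
    and \<gamma>_antisym: "\<gamma> j k x = - \<gamma> k j x"
    and \<gamma>s_antisym: "\<gamma>s j k x = - \<gamma>s k j x"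
    and input_condition:
      "\<sigma> j (\<Phi> (cadjoint (A k) h)) - \<sigma> k (\<Phi> (cadjoint (A j) h)) = \<gamma> j k (\<Phi> h)"
    and output_condition:
      "\<sigma> j (\<Phi> (A k h)) - \<sigma> k (\<Phi> (A j h)) = \<gamma>s j k (\<Phi> h)"
    and linkage_condition:
      "\<gamma>s j k x - \<gamma> j k x =
        \<i> *\<^sub>C (\<sigma> j (\<Phi> (cadjoint \<Phi> (\<sigma> k x))) - \<sigma> k (\<Phi> (cadjoint \<Phi> (\<sigma> j x))))"


section \<open>The VR conditions\<close>

text \<open>The least element of the index type plays the role of the index \<open>1\<close> in \<open>1, \<dots>, d\<close>.\<close>

definition first_index :: "'d::{finite,linorder}"
  where "first_index = Min UNIV"

definition sigma_dir :: "('d \<Rightarrow> 'e \<Rightarrow> 'e) \<Rightarrow> real^'d \<Rightarrow> 'e \<Rightarrow> 'e::complex_hilbert_space"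
  where "sigma_dir \<sigma> \<xi> = (\<lambda>x. \<Sum>j\<in>UNIV. \<xi> $ j *\<^sub>R \<sigma> j x)"

definition sigma_basis ::
    "('d \<Rightarrow> 'e \<Rightarrow> 'e) \<Rightarrow> real^'d^'d \<Rightarrow> 'd \<Rightarrow> 'e \<Rightarrow> 'e::complex_hilbert_space"
  where "sigma_basis \<sigma> T j = (\<lambda>x. \<Sum>i\<in>UNIV. T $ i $ j *\<^sub>R \<sigma> i x)"

definition gamma_basis ::
    "('d \<Rightarrow> 'd \<Rightarrow> 'e \<Rightarrow> 'e) \<Rightarrow> real^'d^'d \<Rightarrow> 'd \<Rightarrow> 'd \<Rightarrow> 'e \<Rightarrow> 'e::complex_hilbert_space"
  where "gamma_basis \<gamma> T j k =
    (\<lambda>x. \<Sum>i\<in>UNIV. \<Sum>l\<in>UNIV. (T $ i $ j * T $ l $ k) *\<^sub>R \<gamma> i l x)"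

definition VR_conditions ::
    "('d::{finite,linorder} \<Rightarrow> 'e \<Rightarrow> 'e) \<Rightarrow> ('d \<Rightarrow> 'd \<Rightarrow> 'e \<Rightarrow> 'e::complex_hilbert_space) \<Rightarrow>
      real^'d::_^'d::_ \<Rightarrow> bool"
  where "VR_conditions \<sigma> \<gamma> T \<longleftrightarrow>
    (let o1 = first_index; s = sigma_basis \<sigma> T; g = gamma_basis \<gamma> T; r = inv (s o1) in
      op_invertible (s o1) \<and>
      (\<forall>j k. j \<noteq> o1 \<longrightarrow> k \<noteq> o1 \<longrightarrow>
        commutator (r \<circ> s j) (r \<circ> s k) = (\<lambda>x. 0) \<and>
        commutator (r \<circ> g o1 j) (r \<circ> g o1 k) = (\<lambda>x. 0) \<and>
        commutator (r \<circ> s k) (r \<circ> g o1 j) = commutator (r \<circ> s j) (r \<circ> g o1 k) \<and>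
        g j k = (\<lambda>x. s j (r (g o1 k x)) - s k (r (g o1 j x)))))"

text \<open>
  The choice of \<open>T\<close> with first column \<open>\<xi>\<close> is immaterial for a vessel; see \<open>VR_direction_iff\<close> below.
\<close>

definition VR_direction ::
    "('d::{finite,linorder} \<Rightarrow> 'e \<Rightarrow> 'e) \<Rightarrow> ('d \<Rightarrow> 'd \<Rightarrow> 'e \<Rightarrow> 'e::complex_hilbert_space) \<Rightarrow>
      real^'d::_ \<Rightarrow> bool"
  where "VR_direction \<sigma> \<gamma> \<xi> \<longleftrightarrow>
    (\<exists>T :: real^'d::_^'d::_. invertible T \<and> T *v axis first_index 1 = \<xi> \<and> VR_conditions \<sigma> \<gamma> T)"

lemma bilinear_zero_on_columns:
  fixes T :: "real^'d^'d::finite" and F :: "real^'d \<Rightarrow> real^'d \<Rightarrow> 'e::real_vector"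
  assumes "invertible T"
    and lin1: "\<And>v. linear (\<lambda>u. F u v)" and lin2: "\<And>u. linear (F u)"
    and zero: "\<And>j k. F (column j T) (column k T) = 0"
  shows "F u v = 0"
proof -
  have span: "span (columns T) = UNIV"
    using assms(1) matrix_right_invertible_span_columns[of T] by (auto simp: invertible_def span_vec_eq)
  have cols: "F (column j T) x = 0" if "x \<in> columns T" for j x
    using that zero by (force simp: columns_def)
  have "F (column j T) v = 0" for j
    using linear_eq_0_on_span[OF lin2[of "column j T"] cols] span by blast
  then have "F x v = 0" if "x \<in> columns T" for x
    using that by (force simp: columns_def)
  then show ?thesis
    using linear_eq_0_on_span[of "\<lambda>u. F u v", OF lin1] span by blast
qed

context vessel
begin

definition gamma_dir :: "real^'d::_ \<Rightarrow> real^'d::_ \<Rightarrow> 'e \<Rightarrow> 'e"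
  where "gamma_dir u v = (\<lambda>x. \<Sum>i\<in>UNIV. \<Sum>l\<in>UNIV. (u $ i * v $ l) *\<^sub>R \<gamma> i l x)"

lemma linear_\<sigma>: "linear (\<sigma> i)" and linear_\<gamma>: "linear (\<gamma> i l)"
  using bounded_\<sigma> bounded_\<gamma> by (auto simp: bounded_clinear_def bounded_linear.linear)

lemma sigma_dir_op:
  "sigma_dir \<sigma> u (x + y) = sigma_dir \<sigma> u x + sigma_dir \<sigma> u y"
  "sigma_dir \<sigma> u (c *\<^sub>R x) = c *\<^sub>R sigma_dir \<sigma> u x"
  using linear_\<sigma>
  by (simp_all add: sigma_dir_def linear_add linear_scale scaleR_add_right sum.distrib
      scaleR_sum_right mult.commute)

lemma gamma_dir_op:
  "gamma_dir u v (x + y) = gamma_dir u v x + gamma_dir u v y"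
  "gamma_dir u v (c *\<^sub>R x) = c *\<^sub>R gamma_dir u v x"
  using linear_\<gamma>
  by (simp_all add: gamma_dir_def linear_add linear_scale scaleR_add_right sum.distrib
      scaleR_sum_right mult_ac)

lemma sigma_dir_vec:
  "sigma_dir \<sigma> (u + v) x = sigma_dir \<sigma> u x + sigma_dir \<sigma> v x"
  "sigma_dir \<sigma> (c *\<^sub>R u) x = c *\<^sub>R sigma_dir \<sigma> u x"
  by (simp_all add: sigma_dir_def scaleR_add_left sum.distrib scaleR_sum_right)

lemma gamma_dir_vec:
  "gamma_dir (u + u') v x = gamma_dir u v x + gamma_dir u' v x"
  "gamma_dir (c *\<^sub>R u) v x = c *\<^sub>R gamma_dir u v x"
  "gamma_dir u (v + v') x = gamma_dir u v x + gamma_dir u v' x"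
  "gamma_dir u (c *\<^sub>R v) x = c *\<^sub>R gamma_dir u v x"
  by (simp_all add: gamma_dir_def scaleR_add_left sum.distrib scaleR_sum_right algebra_simps)

lemma gamma_dir_antisym: "gamma_dir u v x = - gamma_dir v u x"
proof -
  have "gamma_dir u v x = (\<Sum>l\<in>UNIV. \<Sum>i\<in>UNIV. (u $ i * v $ l) *\<^sub>R \<gamma> i l x)"
    unfolding gamma_dir_def by (rule sum.swap)
  also have "\<dots> = (\<Sum>l\<in>UNIV. \<Sum>i\<in>UNIV. - ((v $ l * u $ i) *\<^sub>R \<gamma> l i x))"
    by (intro sum.cong refl) (subst \<gamma>_antisym, simp add: mult.commute)
  finally show ?thesis
    by (simp add: gamma_dir_def sum_negf)
qed

lemma VR_conditions_iff:
  assumes T: "invertible T" and \<xi>: "column first_index T = \<xi>"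
  shows "VR_conditions \<sigma> \<gamma> T \<longleftrightarrow>
    (let S = sigma_dir \<sigma>; G = gamma_dir; r = inv (S \<xi>) in
      op_invertible (S \<xi>) \<and>
      (\<forall>u v x. r (S u (r (S v x))) - r (S v (r (S u x))) = 0 \<and>
        r (G \<xi> u (r (G \<xi> v x))) - r (G \<xi> v (r (G \<xi> u x))) = 0 \<and>
        r (S v (r (G \<xi> u x))) - r (G \<xi> u (r (S v x))) -
          (r (S u (r (G \<xi> v x))) - r (G \<xi> v (r (S u x)))) = 0 \<and>
        G u v x - (S u (r (G \<xi> v x)) - S v (r (G \<xi> u x))) = 0))"
    (is "_ \<longleftrightarrow> ?R")
proof -
  let ?o = "first_index :: 'd"
  define S where "S = sigma_dir \<sigma>"
  define G where "G = gamma_dir"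
  define r where "r = inv (S \<xi>)"
  define F1 where "F1 x u v = r (S u (r (S v x))) - r (S v (r (S u x)))" for x u v
  define F2 where "F2 x u v = r (G \<xi> u (r (G \<xi> v x))) - r (G \<xi> v (r (G \<xi> u x)))" for x u v
  define F3 where "F3 x u v = r (S v (r (G \<xi> u x))) - r (G \<xi> u (r (S v x))) -
          (r (S u (r (G \<xi> v x))) - r (G \<xi> v (r (S u x))))" for x u v
  define F4 where "F4 x u v = G u v x - (S u (r (G \<xi> v x)) - S v (r (G \<xi> u x)))" for x u v
  note F_defs = F1_def F2_def F3_def F4_def
  have sb: "sigma_basis \<sigma> T j = S (column j T)" for j
    by (simp add: sigma_basis_def S_def sigma_dir_def column_def)
  have gb: "gamma_basis \<gamma> T j k = G (column j T) (column k T)" for j k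
    by (simp add: gamma_basis_def G_def gamma_dir_def column_def)
  have VR: "VR_conditions \<sigma> \<gamma> T \<longleftrightarrow> op_invertible (S \<xi>) \<and>
    (\<forall>j k x. j \<noteq> ?o \<longrightarrow> k \<noteq> ?o \<longrightarrow> F1 x (column j T) (column k T) = 0 \<and>
      F2 x (column j T) (column k T) = 0 \<and> F3 x (column j T) (column k T) = 0 \<and>
      F4 x (column j T) (column k T) = 0)"
    unfolding VR_conditions_def Let_def sb gb \<xi> r_def[symmetric] commutator_def fun_eq_iff F_defs
      o_apply right_minus_eq
    by blast
  have R: "?R \<longleftrightarrow> op_invertible (S \<xi>) \<and>
    (\<forall>u v x. F1 x u v = 0 \<and> F2 x u v = 0 \<and> F3 x u v = 0 \<and> F4 x u v = 0)"
    unfolding Let_def F_defs r_def S_def G_def ..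
  show ?thesis
  proof (cases "op_invertible (S \<xi>)")
    case True
    then obtain B where B: "bounded_clinear B" "S \<xi> \<circ> B = id" "B \<circ> S \<xi> = id"
      by (auto simp: op_invertible_def)
    have "r = B"
      unfolding r_def using B by (intro inv_unique_comp) auto
    with B have lin_r: "linear r"
      by (simp add: bounded_clinear_def bounded_linear.linear)
    have rS: "r (S \<xi> x) = x" and Sr: "S \<xi> (r x) = x" for x
      using B \<open>r = B\<close> by (simp_all add: fun_eq_iff)
    note ops = linear_add[OF lin_r] linear_scale[OF lin_r] sigma_dir_op gamma_dir_op
      sigma_dir_vec gamma_dir_vec
    have lin1: "linear (\<lambda>u. F1 x u v)" "linear (\<lambda>u. F2 x u v)" "linear (\<lambda>u. F3 x u v)"
      "linear (\<lambda>u. F4 x u v)" for x v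
      by (rule linearI; simp only: F_defs S_def G_def ops scaleR_right_diff_distrib;
          simp only: diff_conv_add_uminus minus_add_distrib minus_minus ac_simps)+
    have lin2: "linear (F1 x u)" "linear (F2 x u)" "linear (F3 x u)" "linear (F4 x u)" for x u
      by (rule linearI; simp only: F_defs S_def G_def ops scaleR_right_diff_distrib;
          simp only: diff_conv_add_uminus minus_add_distrib minus_minus ac_simps)+
    have r0: "r 0 = 0" and S0: "S u 0 = 0" and G0: "G u v 0 = 0" for u v
      using linear_0[OF lin_r] sigma_dir_op(2)[of u 0 0] gamma_dir_op(2)[of u v 0 0]
      by (auto simp: S_def G_def)
    have G\<xi>: "G \<xi> \<xi> x = 0" for x
    proof -
      have "2 *\<^sub>R G \<xi> \<xi> x = 0"
        using gamma_dir_antisym[of \<xi> \<xi> x] by (simp add: G_def scaleR_2 eq_neg_iff_add_eq_0)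
      then show ?thesis by simp
    qed
    have anti: "G u \<xi> x = - G \<xi> u x" for u x
      unfolding G_def by (rule gamma_dir_antisym)
    have triv: "F1 x \<xi> v = 0" "F1 x u \<xi> = 0" "F2 x \<xi> v = 0" "F2 x u \<xi> = 0"
      "F3 x \<xi> v = 0" "F3 x u \<xi> = 0" "F4 x \<xi> v = 0" "F4 x u \<xi> = 0" for x u v
      using anti[of u x] by (simp_all add: F_defs rS Sr r0 S0 G0 G\<xi>)
    have all: "F1 x u v = 0 \<and> F2 x u v = 0 \<and> F3 x u v = 0 \<and> F4 x u v = 0"
      if "\<forall>j k x. j \<noteq> ?o \<longrightarrow> k \<noteq> ?o \<longrightarrow> F1 x (column j T) (column k T) = 0 \<and>
      F2 x (column j T) (column k T) = 0 \<and> F3 x (column j T) (column k T) = 0 \<and>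
      F4 x (column j T) (column k T) = 0" for x u v
    proof -
      have cols: "F1 x (column j T) (column k T) = 0" "F2 x (column j T) (column k T) = 0"
        "F3 x (column j T) (column k T) = 0" "F4 x (column j T) (column k T) = 0" for j k
        using that \<xi> triv by (cases "j = ?o"; cases "k = ?o"; simp)+
      show ?thesis
        using bilinear_zero_on_columns[OF T, of "F1 x", OF lin1(1) lin2(1) cols(1)]
          bilinear_zero_on_columns[OF T, of "F2 x", OF lin1(2) lin2(2) cols(2)]
          bilinear_zero_on_columns[OF T, of "F3 x", OF lin1(3) lin2(3) cols(3)]
          bilinear_zero_on_columns[OF T, of "F4 x", OF lin1(4) lin2(4) cols(4)]
        by simp
    qed
    show ?thesis
      unfolding VR R
    proof (intro conj_cong refl iffI allI)
      show "F1 x u v = 0 \<and> F2 x u v = 0 \<and> F3 x u v = 0 \<and> F4 x u v = 0"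
        if "\<forall>j k x. j \<noteq> ?o \<longrightarrow> k \<noteq> ?o \<longrightarrow> F1 x (column j T) (column k T) = 0 \<and>
          F2 x (column j T) (column k T) = 0 \<and> F3 x (column j T) (column k T) = 0 \<and>
          F4 x (column j T) (column k T) = 0" for u v x
        using that by (rule all)
    qed simp
  next
    case False
    then show ?thesis
      unfolding VR R by (simp only: simp_thms)
  qed
qed

lemma VR_direction_iff:
  assumes "invertible T" and "T *v axis first_index 1 = \<xi>"
  shows "VR_direction \<sigma> \<gamma> \<xi> \<longleftrightarrow> VR_conditions \<sigma> \<gamma> T"
proof -
  have "VR_conditions \<sigma> \<gamma> T' \<longleftrightarrow> VR_conditions \<sigma> \<gamma> T"
    if "invertible T'" "T' *v axis first_index 1 = \<xi>" for T'
    using assms that unfolding matrix_vector_mult_basis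
    by (intro trans[OF VR_conditions_iff VR_conditions_iff[symmetric]])
  then show ?thesis
    using assms unfolding VR_direction_def by blast
qed

end

end

theory Submission
  imports Defs
begin

text \<open>
  Put \<open>a u = (\<xi>\<sigma>)\<^sup>-\<^sup>1(u\<sigma>)\<close> and \<open>b u = (\<xi>\<sigma>)\<^sup>-\<^sup>1\<gamma>(\<xi>,u)\<close>. The last VR condition expresses every
  \<open>\<gamma>(u,v)\<close> through \<open>a\<close> and \<open>b\<close>, so passing to the direction \<open>\<eta>\<close> replaces \<open>a u\<close> by
  \<open>c u = (a \<eta>)\<^sup>-\<^sup>1(a u)\<close> and \<open>b u\<close> by \<open>b u - c u \<circ> b \<eta>\<close>, and the conditions for the new operators
  are algebraic consequences of those for the old ones. The open set comes from the openness of
  invertibility, applied to the operators \<open>(T\<xi>)\<sigma>\<close> for \<open>T\<close> near the identity.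
\<close>

section \<open>Algebra of the change of direction\<close>

text \<open>The computation takes place among additive maps of an abelian group: \<open>h\<close>
  stands for the new direction and \<open>p\<close> is the inverse of \<open>a h\<close>. The last
  two conclusions rest on \<open>key\<close>, which combines the mixed condition \<open>ab\<close>
  for the three pairs formed from \<open>h\<close>, \<open>u\<close> and \<open>v\<close>.\<close>

lemma VR_commutation_transfer:
  fixes a b :: "'i \<Rightarrow> 'v::ab_group_add \<Rightarrow> 'v" and p :: "'v \<Rightarrow> 'v"
  assumes a_diff: "\<And>u x y. a u (x - y) = a u x - a u y"
    and b_diff: "\<And>u x y. b u (x - y) = b u x - b u y"
    and p_diff: "\<And>x y. p (x - y) = p x - p y"
    and p_a: "\<And>x. p (a h x) = x" and a_p: "\<And>x. a h (p x) = x"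
    and aa: "\<And>u v x. a u (a v x) = a v (a u x)"
    and bb: "\<And>u v x. b u (b v x) = b v (b u x)"
    and ab: "\<And>u v x. a v (b u x) - b u (a v x) = a u (b v x) - b v (a u x)"
    and c_def: "\<And>u x. c u x = p (a u x)"
    and b'_def: "\<And>u x. b' u x = b u x - c u (b h x)"
  shows "c u (c v x) = c v (c u x)"
    and "a u (c v x) = a v (c u x)"
    and "b' u (b' v x) = b' v (b' u x)"
    and "c v (b' u x) - b' u (c v x) = c u (b' v x) - b' v (c u x)"
proof -
  \<comment> \<open>By \<open>aa\<close>, \<open>a u\<close> commutes with \<open>a h\<close>, hence
    with its inverse \<open>p\<close>.\<close>
  have a_p_commute: "a u (p x) = p (a u x)" for u x
    by (metis a_p p_a aa)
  have c_diff: "c u (x - y) = c u x - c u y" for u x y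
    by (simp add: c_def a_diff p_diff)
  show ac: "a u (c v x) = a v (c u x)" for u v x
    by (simp add: c_def a_p_commute aa[of u v])
  show cc: "c u (c v x) = c v (c u x)" for u v x
    by (metis ac c_def)
  \<comment> \<open>This is \<open>ab\<close> for the pair \<open>h\<close>, \<open>u\<close>,
    evaluated at \<open>c v x\<close> and followed by \<open>p\<close>; composing \<open>a h\<close>
    with \<open>c v\<close> gives back \<open>a v\<close>.\<close>
  have twist: "b u (c v x) - p (b u (a v x)) = c u (b h (c v x)) - p (b h (a u (c v x)))" for u v x
  proof -
    have "p (a h (b u (c v x)) - b u (a h (c v x))) = p (a u (b h (c v x)) - b h (a u (c v x)))"
      by (simp only: ab[of h u])
    moreover have "a h (c v x) = a v x"
      by (simp add: c_def a_p)
    ultimately show ?thesis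
      by (simp add: p_diff p_a c_def)
  qed
  have key: "c v (b u x) - b u (c v x) - (c u (b v x) - b v (c u x))
      + (c u (b h (c v x)) - c v (b h (c u x))) = 0" for u v x
  proof -
    have "p (a v (b u x) - b u (a v x)) = p (a u (b v x) - b v (a u x))"
      by (simp only: ab[of v u])
    then have old: "c v (b u x) - p (b u (a v x)) = c u (b v x) - p (b v (a u x))"
      by (simp add: p_diff c_def)
    \<comment> \<open>In the difference of \<open>twist\<close> and its mirror image under exchange
      of \<open>u\<close> and \<open>v\<close>, the terms \<open>p (b h (a u (c v x)))\<close>
      cancel because \<open>ac\<close> makes them symmetric. The terms left over with
      \<open>p\<close> in front are those of \<open>old\<close>.\<close>
    have swap: "c u (b h (c v x)) - c v (b h (c u x)) =
        (b u (c v x) - p (b u (a v x))) - (b v (c u x) - p (b v (a u x)))"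
      unfolding twist ac[of u v] by simp
    show ?thesis
      unfolding swap using old by (simp add: algebra_simps)
  qed
  show "c v (b' u x) - b' u (c v x) = c u (b' v x) - b' v (c u x)"
    using key[of v u x] cc[of u v "b h x"] by (simp add: b'_def c_diff algebra_simps)
  \<comment> \<open>After expansion, \<open>bb\<close> moves \<open>b h\<close> to the right past
    \<open>b u\<close> and \<open>b v\<close>; what remains is \<open>key\<close> at the point
    \<open>b h x\<close>.\<close>
  show "b' u (b' v x) = b' v (b' u x)"
    using key[of v u "b h x"] cc[of u v "b h (b h x)"] bb[of u v x] bb[of h u x] bb[of h v x]
    by (simp add: b'_def c_diff b_diff algebra_simps)
qed

section \<open>Bounded invertible operators and small perturbations of the identity\<close>

lemma op_invertibleE:
  assumes "op_invertible A"
  obtains "bounded_clinear (inv A)" "\<And>x. A (inv A x) = x" "\<And>x. inv A (A x) = x"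
proof -
  from assms obtain B where B: "bounded_clinear B" "A \<circ> B = id" "B \<circ> A = id"
    by (auto simp: op_invertible_def)
  have "inv A = B"
    using B by (intro inv_unique_comp) auto
  with B that show thesis
    by (simp add: fun_eq_iff)
qed

lemma bounded_clinear_comp:
  "bounded_clinear A \<Longrightarrow> bounded_clinear B \<Longrightarrow> bounded_clinear (A \<circ> B)"
  unfolding bounded_clinear_def o_def by (auto intro: bounded_linear_compose)

lemma op_invertible_comp:
  assumes "op_invertible A" "op_invertible B"
  shows "op_invertible (A \<circ> B)"
proof -
  obtain A' B' where "bounded_clinear A'" "A \<circ> A' = id" "A' \<circ> A = id"
    "bounded_clinear B'" "B \<circ> B' = id" "B' \<circ> B = id"
    using assms by (auto simp: op_invertible_def)
  then have "bounded_clinear (B' \<circ> A') \<and> (A \<circ> B) \<circ> (B' \<circ> A') = id \<and> (B' \<circ> A') \<circ> (A \<circ> B) = id"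
    by (simp add: bounded_clinear_comp fun_eq_iff)
  then show ?thesis
    unfolding op_invertible_def by blast
qed

text \<open>The equation \<open>x + K x = y\<close> says that \<open>x\<close> is a fixed point of
  the contraction \<open>y - K x\<close>, so Banach's theorem gives surjectivity. The estimate
  \<open>lower\<close> gives injectivity and bounds the inverse by
  \<open>1 / (1 - q)\<close>.\<close>

lemma op_invertible_id_plus:
  fixes K :: "'a::complex_hilbert_space \<Rightarrow> 'a"
  assumes K: "bounded_clinear K" and bound: "\<And>x. norm (K x) \<le> q * norm x" and "0 \<le> q" "q < 1"
  shows "op_invertible (\<lambda>x. x + K x)"
proof -
  have lin: "linear K" and KC: "K (c *\<^sub>C x) = c *\<^sub>C K x" for c x
    using K by (auto simp: bounded_clinear_def bounded_linear.linear)
  have lower: "(1 - q) * norm x \<le> norm (x + K x)" for x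
    using bound[of x] norm_diff_ineq[of x "K x"] by (simp add: algebra_simps)
  have ex: "\<exists>x. x + K x = y" for y
  proof -
    have "dist (y - K x) (y - K x') \<le> q * dist x x'" for x x'
      using bound[of "x' - x"] by (simp add: dist_norm linear_diff[OF lin] norm_minus_commute)
    then have "\<exists>!x. x \<in> UNIV \<and> y - K x = x"
      using \<open>0 \<le> q\<close> \<open>q < 1\<close> by (intro Banach_fix) (auto simp: complete_UNIV)
    then show ?thesis
      by (metis diff_add_cancel)
  qed
  have inj: "x = x'" if "x + K x = x' + K x'" for x x'
  proof -
    have "(x - x') + K (x - x') = 0"
      using that by (simp add: linear_diff[OF lin] algebra_simps)
    then have "(1 - q) * norm (x - x') \<le> 0"
      using lower[of "x - x'"] by simp
    then show ?thesis
      using \<open>q < 1\<close> by (simp add: mult_le_0_iff)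
  qed
  obtain B where B: "\<And>y. B y + K (B y) = y"
    using ex by metis
  \<comment> \<open>From here on, each identity for \<open>B\<close> is checked through
    \<open>inj\<close>: both sides have the same image under the identity plus
    \<open>K\<close>.\<close>
  have left: "B (x + K x) = x" for x
    by (rule inj) (rule B)
  have "bounded_linear B"
  proof (rule bounded_linear_intro[where K = "1 / (1 - q)"])
    show "B (x + y) = B x + B y" for x y
    proof (rule inj)
      have "B x + B y + K (B x + B y) = (B x + K (B x)) + (B y + K (B y))"
        by (simp only: linear_add[OF lin] ac_simps)
      then show "B (x + y) + K (B (x + y)) = B x + B y + K (B x + B y)"
        by (simp only: B)
    qed
    show "B (r *\<^sub>R x) = r *\<^sub>R B x" for r x
      by (rule inj) (simp only: B linear_scale[OF lin] scaleR_add_right[symmetric])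
    show "norm (B x) \<le> norm x * (1 / (1 - q))" for x
      using lower[of "B x"] B[of x] \<open>q < 1\<close> by (simp add: field_simps)
  qed
  moreover have "B (c *\<^sub>C x) = c *\<^sub>C B x" for c x
    by (rule inj) (simp only: B KC scaleC_add_right[symmetric])
  ultimately show ?thesis
    unfolding op_invertible_def bounded_clinear_def
    using B left by (intro exI[of _ B]) (simp add: fun_eq_iff)
qed

section \<open>Invertible real matrices\<close>

text \<open>An orthogonal matrix carries the axis to the unit vector along \<open>v\<close>, and
  scaling by \<open>norm v\<close> finishes. This supplies the matrix that
  \<open>VR_direction\<close> asks for in a given direction.\<close>

lemma invertible_matrix_with_image_axis:
  fixes v :: "real^'n"
  assumes "v \<noteq> 0"
  obtains T :: "real^'n^'n" where "invertible T" "T *v axis k 1 = v"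
proof -
  obtain Q :: "real^'n^'n" where Q: "orthogonal_matrix Q" "Q *v axis k 1 = v /\<^sub>R norm v"
    using orthogonal_matrix_exists_basis[of "v /\<^sub>R norm v" k] assms by auto
  have "invertible (norm v *\<^sub>R Q)"
    using Q(1) assms
    by (intro scalar_invertible) (auto simp: orthogonal_matrix_def invertible_def)
  moreover have "(norm v *\<^sub>R Q) *v axis k 1 = v"
    using Q(2) assms by (simp flip: scaleR_matrix_vector_assoc)
  ultimately show thesis
    by (rule that)
qed

lemma open_invertible_matrices: "open {T :: real^'n^'n. invertible T}"
proof -
  have "continuous_on UNIV (det :: real^'n^'n \<Rightarrow> real)"
    unfolding det_def[abs_def] by (intro continuous_intros)
  then have "open (det -` (- {0}) :: (real^'n^'n) set)"
    by (intro open_vimage) auto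
  then show ?thesis
    by (simp add: invertible_det_nz vimage_def)
qed

section \<open>Invertibility in nearby directions, and transfer of the VR conditions\<close>

context vessel
begin

lemma bounded_clinear_sigma_dir: "bounded_clinear (sigma_dir \<sigma> u)"
proof -
  have "bounded_linear (sigma_dir \<sigma> u)"
    unfolding sigma_dir_def using bounded_\<sigma>
    by (intro bounded_linear_sum bounded_linear_const_scaleR) (auto simp: bounded_clinear_def)
  moreover have "sigma_dir \<sigma> u (c *\<^sub>C x) = c *\<^sub>C sigma_dir \<sigma> u x" for c x
  proof -
    have add: "Modules.additive (\<lambda>y :: 'e. c *\<^sub>C y)"
      by (simp add: Modules.additive_def scaleC_add_right)
    show ?thesis
      using bounded_\<sigma>
      by (simp add: sigma_dir_def Modules.additive.sum[OF add] bounded_clinear_def scaleC_scaleC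
          mult.commute flip: scaleC_of_real)
  qed
  ultimately show ?thesis
    by (simp add: bounded_clinear_def)
qed

lemma sigma_dir_norm_bound: "\<exists>M>0. \<forall>w x. norm (sigma_dir \<sigma> w x) \<le> M * norm w * norm x"
proof -
  have "\<forall>j. \<exists>m>0. \<forall>x. norm (\<sigma> j x) \<le> norm x * m"
    using bounded_\<sigma> unfolding bounded_clinear_def by (blast intro: bounded_linear.pos_bounded)
  then obtain m where m: "\<And>j. m j > 0" "\<And>j x. norm (\<sigma> j x) \<le> norm x * m j"
    by metis
  have "norm (sigma_dir \<sigma> w x) \<le> sum m UNIV * norm w * norm x" for w x
  proof -
    have "norm (sigma_dir \<sigma> w x) \<le> (\<Sum>j\<in>UNIV. norm w * (norm x * m j))"
      unfolding sigma_dir_def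
      by (rule sum_norm_le) (simp add: mult_mono component_le_norm_cart m)
    then show ?thesis
      by (simp add: sum_distrib_left sum_distrib_right mult_ac)
  qed
  moreover have "sum m UNIV > 0"
    using m by (intro sum_pos) auto
  ultimately show ?thesis
    by blast
qed

text \<open>The operator for \<zeta> is the one for \<xi> composed with the identity plus
  \<open>K\<close>, where \<open>K\<close> is the inverse at \<xi> applied after the operator for
  \<zeta> - \<xi>. The joint bound in direction and vector makes \<open>K\<close> a strict
  contraction once \<zeta> is close to \<xi>.\<close>

lemma op_invertible_sigma_dir_near:
  assumes inv: "op_invertible (sigma_dir \<sigma> \<xi>)"
  shows "\<exists>\<delta>>0. \<forall>\<zeta>. norm (\<zeta> - \<xi>) < \<delta> \<longrightarrow> op_invertible (sigma_dir \<sigma> \<zeta>)"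
proof -
  define r where "r = inv (sigma_dir \<sigma> \<xi>)"
  have r: "bounded_clinear r" "sigma_dir \<sigma> \<xi> (r x) = x" for x
    using inv unfolding r_def by (auto elim: op_invertibleE)
  obtain L where L: "L > 0" "\<And>x. norm (r x) \<le> norm x * L"
    using r(1) unfolding bounded_clinear_def by (blast dest: bounded_linear.pos_bounded)
  obtain M where M: "M > 0" "\<And>w x. norm (sigma_dir \<sigma> w x) \<le> M * norm w * norm x"
    using sigma_dir_norm_bound by blast
  have "op_invertible (sigma_dir \<sigma> \<zeta>)" if near: "norm (\<zeta> - \<xi>) < 1 / (L * M)" for \<zeta>
  proof -
    define K where "K = r \<circ> sigma_dir \<sigma> (\<zeta> - \<xi>)"
    have "norm (K x) \<le> (L * M * norm (\<zeta> - \<xi>)) * norm x" for x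
    proof -
      have "norm (K x) \<le> norm (sigma_dir \<sigma> (\<zeta> - \<xi>) x) * L"
        by (simp add: K_def L)
      also have "\<dots> \<le> M * norm (\<zeta> - \<xi>) * norm x * L"
        using L M by (intro mult_right_mono) auto
      finally show ?thesis
        by (simp add: mult_ac)
    qed
    moreover have "L * M * norm (\<zeta> - \<xi>) < 1"
      using near L M by (simp add: field_simps)
    ultimately have "op_invertible (\<lambda>x. x + K x)"
      using L M r(1) unfolding K_def
      by (intro op_invertible_id_plus bounded_clinear_comp bounded_clinear_sigma_dir) auto
    moreover have "sigma_dir \<sigma> \<zeta> = sigma_dir \<sigma> \<xi> \<circ> (\<lambda>x. x + K x)"
      using sigma_dir_vec(1)[of \<xi> "\<zeta> - \<xi>"] by (simp add: fun_eq_iff K_def r(2) sigma_dir_op)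
    ultimately show ?thesis
      using op_invertible_comp[OF inv] by simp
  qed
  then show ?thesis
    using L M by (intro exI[of _ "1 / (L * M)"]) simp
qed

text \<open>Otherwise the zero operator would be invertible on the nonzero space of
  \<open>E_nonzero\<close>.\<close>

lemma nonzero_if_op_invertible_sigma_dir:
  assumes "op_invertible (sigma_dir \<sigma> \<eta>)"
  shows "\<eta> \<noteq> 0"
proof
  assume "\<eta> = 0"
  then have "sigma_dir \<sigma> \<eta> x = 0" for x
    by (simp add: sigma_dir_def)
  moreover have "inv (sigma_dir \<sigma> \<eta>) (sigma_dir \<sigma> \<eta> x) = x" for x
    using assms by (auto elim: op_invertibleE)
  ultimately have "x = 0" for x :: 'e
    by metis
  then show False
    using E_nonzero by blast
qed

lemma VR_direction_transfer:
  assumes VR: "VR_direction \<sigma> \<gamma> \<xi>" and inv\<eta>: "op_invertible (sigma_dir \<sigma> \<eta>)"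
  shows "VR_direction \<sigma> \<gamma> \<eta>"
proof -
  define S where "S = sigma_dir \<sigma>"
  define G where "G = gamma_dir"
  define r where "r = inv (S \<xi>)"
  define r' where "r' = inv (S \<eta>)"
  obtain T :: "real^'d::_^'d::_" where T: "invertible T" "column first_index T = \<xi>" "VR_conditions \<sigma> \<gamma> T"
    using VR by (auto simp: VR_direction_def matrix_vector_mult_basis)
  have "op_invertible (S \<xi>)"
    and r_VR: "r (S u (r (S v x))) = r (S v (r (S u x)))"
      "r (G \<xi> u (r (G \<xi> v x))) = r (G \<xi> v (r (G \<xi> u x)))"
      "r (S v (r (G \<xi> u x))) - r (G \<xi> u (r (S v x))) =
        r (S u (r (G \<xi> v x))) - r (G \<xi> v (r (S u x)))"
    and G_eq: "G u v x = S u (r (G \<xi> v x)) - S v (r (G \<xi> u x))" for u v x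
    \<comment> \<open>\<open>VR_conditions_iff\<close> gives the conditions for all vectors
      \<open>u\<close>, \<open>v\<close> instead of the columns of \<open>T\<close>; so \<eta>
      itself can be inserted for \<open>u\<close> or \<open>v\<close> below.\<close>
    using VR_conditions_iff[OF T(1,2), THEN iffD1, OF T(3),
      unfolded Let_def, folded S_def G_def, folded r_def, unfolded right_minus_eq]
    by blast+
  define a where "a u x = r (S u x)" for u x
  define b where "b u x = r (G \<xi> u x)" for u x
  define p where "p x = r' (S \<xi> x)" for x
  define c where "c u x = r' (S u x)" for u x
  define b' where "b' u x = r' (G \<eta> u x)" for u x
  have "linear r" and Sr: "S \<xi> (r x) = x" and rS: "r (S \<xi> x) = x" for x
    using \<open>op_invertible (S \<xi>)\<close> unfolding r_def
    by (auto elim!: op_invertibleE simp: bounded_clinear_def bounded_linear.linear)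
  have "linear r'" and Sr': "S \<eta> (r' x) = x" and r'S: "r' (S \<eta> x) = x" for x
    using inv\<eta> unfolding r'_def S_def
    by (auto elim!: op_invertibleE simp: bounded_clinear_def bounded_linear.linear)
  have "linear (S u)" and "linear (G u v)" for u v
    unfolding S_def G_def by (simp_all add: linearI sigma_dir_op gamma_dir_op)
  note diffs = linear_diff[OF \<open>linear r\<close>] linear_diff[OF \<open>linear r'\<close>]
    linear_diff[OF \<open>linear (S _)\<close>] linear_diff[OF \<open>linear (G _ _)\<close>]
  have c_eq: "c u x = p (a u x)" for u x
    by (simp add: c_def p_def a_def Sr)
  \<comment> \<open>This is the old expression for \<open>G \<eta> u\<close>, followed by
    \<open>r'\<close>, which cancels \<open>S \<eta>\<close>.\<close>
  have b'_eq: "b' u x = b u x - c u (b \<eta> x)" for u x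
    by (simp only: b'_def G_eq[of \<eta> u] diffs r'S c_def b_def)
  have "a u (x - y) = a u x - a u y" "b u (x - y) = b u x - b u y" "p (x - y) = p x - p y"
    "p (a \<eta> x) = x" "a \<eta> (p x) = x"
    "a u (a v x) = a v (a u x)" "b u (b v x) = b v (b u x)"
    "a v (b u x) - b u (a v x) = a u (b v x) - b v (a u x)" for u v x y
    unfolding a_def b_def p_def diffs Sr Sr' r'S rS by (rule r_VR refl)+
  note transfer = VR_commutation_transfer[where a = a and b = b and p = p and h = \<eta>
      and c = c and b' = b', OF this c_eq b'_eq]
  have S_c: "S u (c v x) = S v (c u x)" for u v x
    by (metis transfer(2) a_def Sr)
  \<comment> \<open>Replacing \<open>b\<close> by \<open>b'\<close> adds the terms
    \<open>S u (c v (b \<eta> x))\<close> and \<open>S v (c u (b \<eta> x))\<close> with opposite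
    signs; they cancel by \<open>S_c\<close>.\<close>
  have G_eq': "G u v x = S u (b' v x) - S v (b' u x)" for u v x
    by (simp add: G_eq[of u v] b'_eq b_def diffs S_c[of u v])
  obtain T' :: "real^'d::_^'d::_" where T': "invertible T'" "T' *v axis first_index 1 = \<eta>"
    using invertible_matrix_with_image_axis nonzero_if_op_invertible_sigma_dir[OF inv\<eta>] by metis
  have "VR_conditions \<sigma> \<gamma> T'"
    unfolding VR_conditions_iff[OF T'(1) T'(2)[unfolded matrix_vector_mult_basis]] Let_def
      S_def[symmetric] G_def[symmetric] r'_def[symmetric] c_def[symmetric] b'_def[symmetric]
      right_minus_eq
    using inv\<eta> transfer(1,3,4) G_eq' by (auto simp: S_def[symmetric])
  with T' show ?thesis
    unfolding VR_direction_def by blast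
qed

end

theorem corollary4p3:
  fixes \<Phi> :: "'h::complex_hilbert_space \<Rightarrow> 'e::complex_hilbert_space"
    and A :: "'d::{finite,linorder} \<Rightarrow> 'h \<Rightarrow> 'h"
    and \<sigma> :: "'d \<Rightarrow> 'e \<Rightarrow> 'e"
    and \<gamma> \<gamma>s :: "'d \<Rightarrow> 'd \<Rightarrow> 'e \<Rightarrow> 'e"
    and \<xi> \<eta> :: "real^'d::_"
  assumes "vessel \<Phi> A \<sigma> \<gamma> \<gamma>s"
    and "op_invertible (sigma_dir \<sigma> \<xi>)"
    and "op_invertible (sigma_dir \<sigma> \<eta>)"
    and "VR_direction \<sigma> \<gamma> \<xi>"
  shows "VR_direction \<sigma> \<gamma> \<eta> \<and>
    (\<exists>U :: (real^'d::_^'d::_) set. U \<noteq> {} \<and> open U \<and> U \<subseteq> {T. invertible T} \<and>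
      (\<forall>T\<in>U. VR_direction \<sigma> \<gamma> (T *v \<xi>)))"
proof -
  interpret vessel \<Phi> A \<sigma> \<gamma> \<gamma>s by fact
  obtain \<delta> where \<delta>: "\<delta> > 0" "\<And>\<zeta>. norm (\<zeta> - \<xi>) < \<delta> \<Longrightarrow> op_invertible (sigma_dir \<sigma> \<zeta>)"
    using op_invertible_sigma_dir_near[OF assms(2)] by blast
  \<comment> \<open>The matrices here move \<xi> by less than \<delta>, so the operator in direction
    \<open>T *v \<xi>\<close> stays invertible. The identity matrix fixes \<xi> and witnesses that
    \<open>U\<close> is not empty.\<close>
  define U :: "(real^'d::_^'d::_) set" where "U = {T. invertible T} \<inter> (\<lambda>T. T *v \<xi>) -` ball \<xi> \<delta>"
  have "continuous_on UNIV (\<lambda>T :: real^'d::_^'d::_. T *v \<xi>)"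
    unfolding matrix_vector_mult_def by (intro continuous_intros)
  then have "open U"
    unfolding U_def by (intro open_Int open_invertible_matrices open_vimage) auto
  moreover have "mat 1 \<in> U"
    using \<delta>(1) by (simp add: U_def invertible_def)
  moreover have "VR_direction \<sigma> \<gamma> (T *v \<xi>)" if "T \<in> U" for T
    using that VR_direction_transfer[OF assms(4)] \<delta>(2)
    by (simp add: U_def dist_norm norm_minus_commute)
  ultimately show ?thesis
    using VR_direction_transfer[OF assms(4,3)] by (intro conjI exI[of _ U]) (auto simp: U_def)
qed

end
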